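(* Let $K\subset\mathbb{R}^n$ be a polyhedral cone and let $d\in\mathbb{R}^n$ be its circumcentric direction. Then $d+v\in K^{\circ}$ for all $v\in\mathbb{R}^n$ such that $\|v\|\le \|d\|^2$; in particular, $d\in K^{\circ}$. Moreover, if $d\neq 0$, then $d+v\in \operatorname{int}(K^{\circ})$ for all $v\in\mathbb{R}^n$ with $\|v\|<\|d\|^2$.
   Context: $\mathbb{R}^n$ carries the Euclidean inner product $\langle\cdot,\cdot\rangle$ and norm $\|\cdot\|$. A cone is a subset of $\mathbb{R}^n$ closed under multiplication by positive scalars. A polyhedral cone is a cone that is also a polyhedron (a finite intersection of closed half-spaces); equivalently, a finitely generated cone. For $X\subset\mathbb{R}^n$, the polar of $X$ is $X^{\circ}=\{w\in\mathbb{R}^n : \langle z,w\rangle\le 0 \ \text{for all } z\in X\}$, and $\operatorname{cone}(X)$ is the set of all conic combinations (finite linear combinations with nonnegative coefficients) of elements of $X$. $\operatorname{int}$ denotes the interior. Circumcenter: for a finite set $S=\{u^1,\dots,u^p\}\subset\mathbb{R}^n$ ($p\ge 1$), the circumcenter $\operatorname{circ}(S)$ is the point $c$ (unique if it exists) such that $c\in\operatorname{aff}(S)$ (the smallest affine subspace containing $S$) and $\|c-u^1\|=\cdots=\|c-u^p\|$. A finite set $B_K\subset\mathbb{R}^n$ is a conic base of a finitely generated cone $K$ if it has minimal cardinality among the finite sets $B$ with $\operatorname{cone}(B)=K$; it is normalized if all its vectors have norm one. Circumcentric direction: if $K\neq\{0\}$ is a polyhedral cone and $B_K$ is a normalized conic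 base of $K$, the circumcentric direction of $K$ is $d_{\operatorname{circ}}(K)=-\operatorname{circ}(B_K)$ (this exists and does not depend on the choice of $B_K$). If $K=\{0\}$, its circumcentric direction is $0$. *)

theory Defs
  imports "HOL-Analysis.Analysis"
begin

text \<open>The library's \<open>conic\<close> also demands closure under multiplication by \<open>0\<close>; here a cone
  is only closed under positive scalars. The empty set satisfies the two closure conditions
  literally, but is excluded, since polyhedral cones are to be the finitely generated ones
  (and the empty set has no generating set).\<close>

definition polyhedral_cone :: "'a::euclidean_space set \<Rightarrow> bool" where
  "polyhedral_cone K \<longleftrightarrow>
     K \<noteq> {} \<and> polyhedron K \<and> (\<forall>x\<in>K. \<forall>t>0. t *\<^sub>R x \<in> K)"

definition polar :: "'a::euclidean_space set \<Rightarrow> 'a set" where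
  "polar X = {w. \<forall>z\<in>X. z \<bullet> w \<le> 0}"

definition conic_combinations :: "'a::euclidean_space set \<Rightarrow> 'a set" where
  "conic_combinations X =
     {\<Sum>x\<in>F. a x *\<^sub>R x | F a. finite F \<and> F \<subseteq> X \<and> (\<forall>x\<in>F. 0 \<le> a x)}"

definition is_circumcenter :: "'a::euclidean_space set \<Rightarrow> 'a \<Rightarrow> bool" where
  "is_circumcenter S c \<longleftrightarrow>
     c \<in> affine hull S \<and> (\<forall>u\<in>S. \<forall>v\<in>S. norm (c - u) = norm (c - v))"

definition circ :: "'a::euclidean_space set \<Rightarrow> 'a" where
  "circ S = (THE c. is_circumcenter S c)"

definition conic_base :: "'a::euclidean_space set \<Rightarrow> 'a set \<Rightarrow> bool" where
  "conic_base B K \<longleftrightarrow>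
     finite B \<and> conic_combinations B = K \<and>
     (\<forall>B'. finite B' \<and> conic_combinations B' = K \<longrightarrow> card B \<le> card B')"

definition normalized_conic_base :: "'a::euclidean_space set \<Rightarrow> 'a set \<Rightarrow> bool" where
  "normalized_conic_base B K \<longleftrightarrow> conic_base B K \<and> (\<forall>u\<in>B. norm u = 1)"

text \<open>The definite description ranges over all normalized conic bases, so it denotes a
  meaningful vector because \<open>circ B\<close> is the same for every such \<open>B\<close>.\<close>

definition circumcentric_direction :: "'a::euclidean_space set \<Rightarrow> 'a" where
  "circumcentric_direction K =
     (if K = {0} then 0
      else (THE d. \<exists>B. normalized_conic_base B K \<and> d = - circ B))"

end

(* The circumcenter c of a set of unit vectors is the point of its affine hull closest to the
   origin, and so is characterised by <c, u> = <c, c> for all generators u. With d = -c this gives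
   <u, d + v> <= -|d|^2 + |v| for every generator u, which is the claim.
   It remains to see that d is well defined. Minkowski-Weyl (by intersecting K with a box) and
   rescaling give a normalized base. If some base has circumcenter c other than 0, then <c, .> is
   positive on K outside 0, so K is pointed; its bases then consist of the unit vectors on the
   extreme rays, hence coincide. Otherwise every base has circumcenter 0. *)
theory Submission
  imports Defs
begin

section \<open>Circumcenters of unit vectors\<close>

lemma affine_hull_inner_eq:
  fixes c :: "'a::real_inner"
  assumes "\<And>u. u \<in> S \<Longrightarrow> c \<bullet> u = k" and "x \<in> affine hull S"
  shows "c \<bullet> x = k"
proof -
  have "affine {x. c \<bullet> x = k}"
    by (rule affine_hyperplane)
  then have "affine hull S \<subseteq> {x. c \<bullet> x = k}"
    using assms(1) by (intro hull_minimal) auto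
  with assms(2) show ?thesis by auto
qed

text \<open>For unit \<open>u\<close> the squared distance to \<open>c\<close> is
  \<open>c \<bullet> c - 2 * (c \<bullet> u) + 1\<close>, so equidistance says that the functional
  of \<open>c\<close> is constant on \<open>S\<close>. It is then constant on the affine hull too,
  and evaluating it at \<open>c\<close> itself identifies the constant.\<close>

lemma is_circumcenter_unit_iff:
  assumes unit: "\<forall>u\<in>S. norm u = 1"
  shows "is_circumcenter S c \<longleftrightarrow> c \<in> affine hull S \<and> (\<forall>u\<in>S. c \<bullet> u = c \<bullet> c)"
proof -
  have dist_eq: "norm (c - u) = norm (c - v) \<longleftrightarrow> c \<bullet> u = c \<bullet> v" if "u \<in> S" "v \<in> S" for u v
  proof -
    have "u \<bullet> u = 1" "v \<bullet> v = 1"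
      using that unit by (auto simp: norm_eq_1)
    then show ?thesis
      by (simp add: norm_eq inner_diff_left inner_diff_right inner_commute)
  qed
  have "c \<bullet> u = c \<bullet> c" if c: "is_circumcenter S c" and u: "u \<in> S" for u
  proof -
    have "c \<bullet> v = c \<bullet> u" if "v \<in> S" for v
      using c u that dist_eq unfolding is_circumcenter_def by blast
    then show ?thesis
      using affine_hull_inner_eq[of S c "c \<bullet> u" c] c by (simp add: is_circumcenter_def)
  qed
  moreover have "is_circumcenter S c" if "c \<in> affine hull S" "\<forall>u\<in>S. c \<bullet> u = c \<bullet> c"
    unfolding is_circumcenter_def using that by (simp add: dist_eq)
  ultimately show ?thesis
    unfolding is_circumcenter_def by blast
qed

text \<open>Each circumcenter lies in the affine hull, on which the functional of the other is
  constant; the two resulting identities make the squared norm of \<open>c - c'\<close>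
  vanish.\<close>

lemma is_circumcenter_unit_unique:
  assumes unit: "\<forall>u\<in>S. norm u = 1" and "is_circumcenter S c" "is_circumcenter S c'"
  shows "c = c'"
proof -
  have "c \<bullet> c' = c \<bullet> c" "c' \<bullet> c = c' \<bullet> c'"
    using assms(2,3) unfolding is_circumcenter_unit_iff[OF unit]
    by (blast intro: affine_hull_inner_eq)+
  then have "(c - c') \<bullet> (c - c') = 0"
    by (simp add: inner_diff_left inner_diff_right inner_commute)
  then show ?thesis by simp
qed

lemma is_circumcenter_unit_exists:
  assumes unit: "\<forall>u\<in>S. norm u = 1" and "S \<noteq> {}"
  shows "\<exists>c. is_circumcenter S c"
proof -
  let ?A = "affine hull S"
  define c where "c = closest_point ?A 0"
  have c: "c \<in> ?A"
    unfolding c_def using assms(2) by (intro closest_point_in_set) auto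
  \<comment> \<open>The variational inequality for the projection of the origin onto a convex
    set.\<close>
  have le: "c \<bullet> c \<le> c \<bullet> x" if "x \<in> ?A" for x
    using closest_point_dot[of ?A x 0] that
    by (simp add: c_def[symmetric] affine_imp_convex inner_diff_right)
  have "c \<bullet> u = c \<bullet> c" if "u \<in> S" for u
  proof -
    have u: "u \<in> ?A" using that by (rule hull_inc)
    \<comment> \<open>The reflection of \<open>u\<close> through \<open>c\<close> stays in the
      affine hull; minimality at \<open>u\<close> and at its reflection gives the two opposite
      inequalities.\<close>
    have "2 *\<^sub>R c + (-1) *\<^sub>R u \<in> ?A"
      by (rule mem_affine[OF affine_affine_hull c u]) simp
    from le[OF this] le[OF u] show ?thesis
      by (simp add: inner_diff_right inner_add_right)
  qed
  with c show ?thesis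
    by (auto simp: is_circumcenter_unit_iff[OF unit])
qed

lemma is_circumcenter_circ:
  assumes "\<forall>u\<in>S. norm u = 1" and "S \<noteq> {}"
  shows "is_circumcenter S (circ S)"
proof -
  have "\<exists>!c. is_circumcenter S c"
    using is_circumcenter_unit_exists[OF assms] is_circumcenter_unit_unique[OF assms(1)] by blast
  then show ?thesis
    unfolding circ_def by (rule theI')
qed

lemma inner_circ:
  assumes "\<forall>u\<in>S. norm u = 1" and "u \<in> S"
  shows "circ S \<bullet> u = circ S \<bullet> circ S"
  using is_circumcenter_circ[of S] assms by (auto simp: is_circumcenter_unit_iff[OF assms(1)])

section \<open>Finitely generated cones\<close>

text \<open>Makes the hull calculus available for generated cones. The empty sum supplies the
  origin, so the two sides also agree for empty \<open>X\<close>.\<close>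

lemma conic_combinations_eq_hull: "conic_combinations X = convex_cone hull X"
proof
  show "conic_combinations X \<subseteq> convex_cone hull X"
  proof
    fix x assume "x \<in> conic_combinations X"
    then obtain F a where x: "x = (\<Sum>y\<in>F. a y *\<^sub>R y)" and "finite F"
      and "F \<subseteq> X" "\<forall>y\<in>F. 0 \<le> a y"
      by (auto simp: conic_combinations_def)
    from \<open>finite F\<close> this(3,4) show "x \<in> convex_cone hull X"
      unfolding x
      by (induction F rule: finite_induct)
        (auto intro!: convex_cone_hull_contains_0 convex_cone_hull_add convex_cone_hull_mul
          intro: hull_inc)
  qed
next
  show "convex_cone hull X \<subseteq> conic_combinations X"
  proof (rule hull_minimal)
    show "X \<subseteq> conic_combinations X"
    proof
      fix x assume "x \<in> X"
      then show "x \<in> conic_combinations X"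
        unfolding conic_combinations_def
        by (intro CollectI exI[of _ "{x}"] exI[of _ "\<lambda>_. 1"]) auto
    qed
    have zero: "0 \<in> conic_combinations X"
      unfolding conic_combinations_def by (intro CollectI exI[of _ "{}"]) auto
    have scale: "t *\<^sub>R x \<in> conic_combinations X"
      if x_in: "x \<in> conic_combinations X" and t: "0 \<le> t" for x t
    proof -
      obtain F a where x: "x = (\<Sum>y\<in>F. a y *\<^sub>R y)" "finite F"
        "F \<subseteq> X" "\<forall>y\<in>F. 0 \<le> a y"
        using x_in unfolding conic_combinations_def by blast
      show ?thesis
        unfolding conic_combinations_def
        by (intro CollectI exI[of _ F] exI[of _ "\<lambda>y. t * a y"])
          (use x t in \<open>simp add: scaleR_right.sum\<close>)
    qed
    have add: "x + y \<in> conic_combinations X"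
      if x_in: "x \<in> conic_combinations X" and y_in: "y \<in> conic_combinations X" for x y
    proof -
      obtain F a where x: "x = (\<Sum>z\<in>F. a z *\<^sub>R z)" "finite F"
        "F \<subseteq> X" "\<forall>z\<in>F. 0 \<le> a z"
        using x_in unfolding conic_combinations_def by blast
      obtain G b where y: "y = (\<Sum>z\<in>G. b z *\<^sub>R z)" "finite G"
        "G \<subseteq> X" "\<forall>z\<in>G. 0 \<le> b z"
        using y_in unfolding conic_combinations_def by blast
      \<comment> \<open>The two supports may differ, so both coefficient families are padded with
        zeros to the union before being added.\<close>
      define c where "c z = (if z \<in> F then a z else 0) + (if z \<in> G then b z else 0)" for z
      have "x = (\<Sum>z\<in>F \<union> G. (if z \<in> F then a z else 0) *\<^sub>R z)"
        unfolding x(1) by (rule sum.mono_neutral_cong_left) (use x(2) y(2) in auto)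
      moreover have "y = (\<Sum>z\<in>F \<union> G. (if z \<in> G then b z else 0) *\<^sub>R z)"
        unfolding y(1) by (rule sum.mono_neutral_cong_left) (use x(2) y(2) in auto)
      ultimately have "x + y = (\<Sum>z\<in>F \<union> G. c z *\<^sub>R z)"
        by (simp add: c_def scaleR_add_left sum.distrib)
      moreover have "\<forall>z\<in>F \<union> G. 0 \<le> c z"
        using x(4) y(4) by (auto simp: c_def)
      ultimately show ?thesis
        unfolding conic_combinations_def
        using x(2,3) y(2,3) by (intro CollectI exI[of _ "F \<union> G"] exI[of _ c]) simp
    qed
    show "convex_cone (conic_combinations X)"
      using zero scale add by (simp add: convex_cone_iff)
  qed
qed

text \<open>The truncation of \<open>K\<close> by a box is a polytope, and a finite set spanning it
  convexly generates \<open>K\<close>, since every point of \<open>K\<close> can be scaled into the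
  box.\<close>

lemma polyhedral_cone_finitely_generated:
  assumes "polyhedral_cone K"
  shows "\<exists>B. finite B \<and> convex_cone hull B = K"
proof -
  from assms have "K \<noteq> {}" and K: "polyhedron K"
    and pos: "\<And>x t. x \<in> K \<Longrightarrow> 0 < t \<Longrightarrow> t *\<^sub>R x \<in> K"
    by (auto simp: polyhedral_cone_def)
  then obtain x where x: "x \<in> K" by blast
  \<comment> \<open>Only positive scalars are allowed so far; the origin is reached as a limit of
    shrinking multiples, because polyhedra are closed.\<close>
  have "(\<lambda>n. inverse (real (Suc n)) *\<^sub>R x) \<longlonglongrightarrow> 0 *\<^sub>R x"
    by (intro tendsto_intros LIMSEQ_inverse_real_of_nat)
  then have zero: "0 \<in> K"
    using closed_sequentially[OF polyhedron_imp_closed[OF K], of "\<lambda>n. inverse (real (Suc n)) *\<^sub>R x"]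
      pos[OF x] by simp
  have scale: "t *\<^sub>R y \<in> K" if "y \<in> K" "0 \<le> t" for y t
    using that pos[of y t] zero by (cases "t = 0") auto
  have "cone K" "convex K"
    using scale K by (auto simp: cone_def polyhedron_imp_convex)
  then have cc: "convex_cone K"
    using convex_cone[of K] zero by (simp add: convex_cone_iff)
  \<comment> \<open>The box has to contain the unit ball, so that \<open>sgn y\<close> survives the
    truncation for every \<open>y\<close> in \<open>K\<close>.\<close>
  obtain a :: 'a where a: "cball 0 1 \<subseteq> cbox (-a) a"
    using bounded_subset_cbox_symmetric[OF bounded_cball] by blast
  have "polytope (K \<inter> cbox (-a) a)"
    using K by (simp add: polyhedron_Int_polytope polytope_interval)
  then obtain V where V: "finite V" "K \<inter> cbox (-a) a = convex hull V"
    by (auto simp: polytope_def)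
  have "convex_cone hull V \<subseteq> K"
    using V(2) hull_subset[of V convex] cc by (intro hull_minimal) auto
  moreover have "y \<in> convex_cone hull V" if y: "y \<in> K" for y
  proof -
    have "sgn y \<in> K"
      using scale[OF y, of "inverse (norm y)"] by (simp add: sgn_div_norm)
    moreover have "sgn y \<in> cball 0 1"
      by (simp add: norm_sgn)
    ultimately have "sgn y \<in> convex_cone hull V"
      using a V(2) convex_hull_subset_convex_cone_hull[of V] by blast
    from convex_cone_hull_mul[OF this norm_ge_zero[of y]] show ?thesis
      by (cases "y = 0") (simp_all add: sgn_div_norm)
  qed
  ultimately show ?thesis
    using V(1) by blast
qed

lemma conic_base_hull: "conic_base B K \<Longrightarrow> convex_cone hull B = K"
  by (simp add: conic_base_def conic_combinations_eq_hull)

text \<open>A redundant generator could be dropped, contradicting minimal cardinality.\<close>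

lemma conic_base_irredundant:
  assumes "conic_base B K" and "u \<in> B"
  shows "u \<notin> convex_cone hull (B - {u})"
proof
  assume "u \<in> convex_cone hull (B - {u})"
  then have "convex_cone hull (insert u (B - {u})) = convex_cone hull (B - {u})"
    by (rule hull_redundant)
  then have "convex_cone hull (B - {u}) = K"
    using assms conic_base_hull[of B K] by (simp add: insert_absorb)
  then have "card B \<le> card (B - {u})"
    using assms(1) by (simp add: conic_base_def conic_combinations_eq_hull)
  then show False
    using assms by (metis card_Diff1_less conic_base_def not_less)
qed

lemma conic_base_nonzero: "conic_base B K \<Longrightarrow> u \<in> B \<Longrightarrow> u \<noteq> 0"
  using conic_base_irredundant convex_cone_hull_contains_0 by blast

lemma normalized_conic_base_exists:
  assumes "polyhedral_cone K"
  shows "\<exists>B. normalized_conic_base B K"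
proof -
  define P where "P B \<longleftrightarrow> finite B \<and> conic_combinations B = K" for B
  have "\<exists>B. P B"
    using polyhedral_cone_finitely_generated[OF assms]
    by (simp add: P_def conic_combinations_eq_hull)
  then obtain B where "P B" and min: "\<And>B'. P B' \<Longrightarrow> card B \<le> card B'"
    using ex_has_least_nat[of P _ card] by blast
  then have B: "conic_base B K"
    by (auto simp: conic_base_def P_def)
  have "sgn u \<in> convex_cone hull B" if "u \<in> B" for u
    using convex_cone_hull_mul[OF hull_inc[OF that], of "inverse (norm u)"]
    by (simp add: sgn_div_norm)
  moreover have "u \<in> convex_cone hull (sgn ` B)" if "u \<in> B" for u
  proof -
    have "norm u *\<^sub>R sgn u \<in> convex_cone hull (sgn ` B)"
      using that by (intro convex_cone_hull_mul hull_inc) auto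
    then show ?thesis
      using conic_base_nonzero[OF B that] by (simp add: sgn_div_norm)
  qed
  ultimately have "convex_cone hull (sgn ` B) = convex_cone hull B"
    by (intro subset_antisym hull_minimal) (auto simp: convex_cone_convex_cone_hull)
  then have "P (sgn ` B)"
    using \<open>P B\<close> by (simp add: P_def conic_combinations_eq_hull)
  \<comment> \<open>Normalizing may merge generators but never adds any, so minimality is
    preserved.\<close>
  moreover have "card (sgn ` B) \<le> card B"
    using \<open>P B\<close> by (simp add: P_def card_image_le)
  ultimately have "conic_base (sgn ` B) K"
    using min by (auto simp: conic_base_def P_def intro: order_trans)
  then show ?thesis
    using conic_base_nonzero[OF B] by (auto simp: normalized_conic_base_def norm_sgn)
qed

section \<open>Uniqueness of the normalized base of a pointed cone\<close>

lemma convex_cone_hull_insertE: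
  assumes "x \<in> convex_cone hull (insert u S)"
  obtains a y where "0 \<le> a" "y \<in> convex_cone hull S" "x = a *\<^sub>R u + y"
proof -
  have "x \<in> convex_cone hull ({u} \<union> S)"
    using assms by simp
  then obtain p y where p: "p \<in> convex_cone hull {u}" "y \<in> convex_cone hull S" "x = p + y"
    unfolding convex_cone_hull_Un by blast
  obtain a where "0 \<le> a" "p = a *\<^sub>R u"
    using p(1) by (auto simp: convex_cone_hull_convex_hull_nonempty)
  with p that show thesis by blast
qed

text \<open>Base vectors span extreme rays when some functional is positive on \<open>K\<close> away
  from the origin. Split \<open>p\<close> and \<open>q\<close> into a multiple of \<open>u\<close>
  and a remainder generated by the other base vectors; irredundancy and positivity together kill the
  remainder of \<open>p\<close>.\<close>

lemma conic_base_extreme_ray: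
  assumes B: "conic_base B K" and "u \<in> B"
    and pos: "\<And>x. x \<in> K \<Longrightarrow> x \<noteq> 0 \<Longrightarrow> 0 < c \<bullet> x"
    and "p \<in> K" "q \<in> K" "u = p + q"
  shows "\<exists>a\<ge>0. p = a *\<^sub>R u"
proof -
  let ?C = "convex_cone hull (B - {u})"
  have K: "K = convex_cone hull (insert u (B - {u}))"
    using assms(2) conic_base_hull[OF B] by (simp add: insert_absorb)
  obtain a p' where p: "0 \<le> a" "p' \<in> ?C" "p = a *\<^sub>R u + p'"
    using \<open>p \<in> K\<close> unfolding K by (rule convex_cone_hull_insertE)
  obtain b q' where q: "0 \<le> b" "q' \<in> ?C" "q = b *\<^sub>R u + q'"
    using \<open>q \<in> K\<close> unfolding K by (rule convex_cone_hull_insertE)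
  have sum: "(1 - a - b) *\<^sub>R u = p' + q'"
    using \<open>u = p + q\<close> p(3) q(3) by (simp add: algebra_simps)
  \<comment> \<open>Otherwise dividing \<open>sum\<close> by the positive number
    \<open>1 - a - b\<close> would express \<open>u\<close> through the other generators.\<close>
  have "a + b \<ge> 1"
  proof (rule ccontr)
    assume "\<not> a + b \<ge> 1"
    then have "inverse (1 - a - b) *\<^sub>R (p' + q') \<in> ?C"
      by (intro convex_cone_hull_mul convex_cone_hull_add p q) simp
    then have "u \<in> ?C"
      using \<open>\<not> a + b \<ge> 1\<close> unfolding sum[symmetric] by simp
    with conic_base_irredundant[OF B \<open>u \<in> B\<close>] show False by contradiction
  qed
  have sub: "?C \<subseteq> K"
    unfolding K by (intro hull_mono) auto
  have nonneg: "0 \<le> c \<bullet> x" if "x \<in> K" for x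
    using pos[OF that] by (cases "x = 0") auto
  have "u \<in> K"
    using hull_inc[OF \<open>u \<in> B\<close>] conic_base_hull[OF B] by blast
  \<comment> \<open>Applying the functional to \<open>sum\<close> shows that two nonnegative values
    add up to a nonpositive one, so both vanish.\<close>
  have "(1 - a - b) * (c \<bullet> u) = c \<bullet> p' + c \<bullet> q'"
    using arg_cong[OF sum, of "inner c"] by (simp add: inner_add_right)
  moreover have "(1 - a - b) * (c \<bullet> u) \<le> 0"
    using \<open>a + b \<ge> 1\<close> nonneg[OF \<open>u \<in> K\<close>] by (intro mult_nonpos_nonneg) auto
  ultimately have "c \<bullet> p' \<le> 0"
    using nonneg[of q'] q(2) sub by auto
  then have "p' = 0"
    using pos[of p'] p(2) sub by force
  with p show ?thesis by auto
qed

text \<open>Expand \<open>u\<close> over \<open>B'\<close>: by extremality any nonzero term of the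
  expansion lies on the ray of \<open>u\<close>, and unit norms then turn the generator in that term
  into \<open>u\<close> itself.\<close>

lemma normalized_conic_base_subset:
  assumes B: "normalized_conic_base B K" and B': "normalized_conic_base B' K"
    and pos: "\<And>x. x \<in> K \<Longrightarrow> x \<noteq> 0 \<Longrightarrow> 0 < c \<bullet> x"
  shows "B \<subseteq> B'"
proof
  fix u assume u: "u \<in> B"
  have base: "conic_base B K" "conic_base B' K" and unit: "norm u = 1" "\<forall>w\<in>B'. norm w = 1"
    using B B' u by (auto simp: normalized_conic_base_def)
  note K = conic_base_hull[OF base(2)]
  have "u \<in> conic_combinations B'"
    using u hull_inc[of u B convex_cone] conic_base_hull[OF base(1)] base(2)
    by (simp add: conic_base_def)
  then obtain F a where F: "u = (\<Sum>w\<in>F. a w *\<^sub>R w)" "finite F" "F \<subseteq> B'" "\<forall>w\<in>F. 0 \<le> a w"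
    by (auto simp: conic_combinations_def)
  have "u \<noteq> 0" using unit(1) by auto
  then obtain w where w: "w \<in> F" "a w *\<^sub>R w \<noteq> 0"
    using F(1) by (auto elim: sum.not_neutral_contains_not_neutral)
  define q where "q = (\<Sum>w\<in>F - {w}. a w *\<^sub>R w)"
  have "a w *\<^sub>R w \<in> K"
    using w(1) F(3,4) unfolding K[symmetric] by (intro convex_cone_hull_mul hull_inc) auto
  moreover have "q \<in> K"
    using F unfolding K[symmetric] conic_combinations_eq_hull[symmetric]
    by (auto simp: q_def conic_combinations_def)
  moreover have "u = a w *\<^sub>R w + q"
    unfolding q_def using F(1,2) w(1) by (simp add: sum.remove)
  ultimately obtain b where b: "0 \<le> b" "a w *\<^sub>R w = b *\<^sub>R u"
    using conic_base_extreme_ray[OF base(1) u pos] by blast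
  \<comment> \<open>Both coefficients are nonnegative and both vectors have norm one, so taking
    norms equates the coefficients.\<close>
  have "norm w = 1" "0 \<le> a w"
    using w(1) F(3,4) unit(2) by auto
  then have "a w = b"
    using arg_cong[OF b(2), of norm] b(1) unit(1) by simp
  then have "w = u"
    using b(2) w(2) by auto
  then show "u \<in> B'"
    using w(1) F(3) by blast
qed

text \<open>An open half-space through the origin, with the origin adjoined, is a convex
  cone.\<close>

lemma convex_cone_hull_pos_functional:
  fixes c :: "'a::real_inner"
  assumes "\<And>u. u \<in> S \<Longrightarrow> 0 < c \<bullet> u" and "x \<in> convex_cone hull S" and "x \<noteq> 0"
  shows "0 < c \<bullet> x"
proof -
  have "convex_cone {x. x = 0 \<or> 0 < c \<bullet> x}"
    by (auto simp: convex_cone_iff inner_add_right)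
  then have "convex_cone hull S \<subseteq> {x. x = 0 \<or> 0 < c \<bullet> x}"
    using assms(1) by (intro hull_minimal) auto
  with assms(2,3) show ?thesis by auto
qed

text \<open>The functional of \<open>circ B\<close> is positive on the generators in
  \<open>B\<close>, hence on \<open>K\<close> away from the origin. As this concerns
  \<open>K\<close> alone, the same functional serves both inclusions.\<close>

lemma normalized_conic_base_unique:
  assumes B: "normalized_conic_base B K" and B': "normalized_conic_base B' K"
    and "circ B \<noteq> 0"
  shows "B = B'"
proof -
  have unit: "\<forall>u\<in>B. norm u = 1" and K: "convex_cone hull B = K"
    using B by (auto simp: normalized_conic_base_def conic_base_hull)
  have "0 < circ B \<bullet> u" if "u \<in> B" for u
    using inner_circ[OF unit that] assms(3) by simp
  then have pos: "0 < circ B \<bullet> x" if "x \<in> K" "x \<noteq> 0" for x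
    using that unfolding K[symmetric] by (rule convex_cone_hull_pos_functional)
  show ?thesis
    using normalized_conic_base_subset[OF B B' pos] normalized_conic_base_subset[OF B' B pos]
    by (rule subset_antisym)
qed

lemma circumcentric_direction_eq:
  assumes "normalized_conic_base B K" and "K \<noteq> {0}"
  shows "circumcentric_direction K = - circ B"
proof -
  have eq: "circ B' = circ B" if B': "normalized_conic_base B' K" for B'
  proof (cases "circ B = 0")
    \<comment> \<open>The bases may differ here, but a base \<open>B'\<close> with nonzero
      circumcenter would be the only one and hence equal \<open>B\<close>.\<close>
    case True
    then show ?thesis
      using normalized_conic_base_unique[OF B' assms(1)] by (cases "circ B' = 0") auto
  next
    case False
    from normalized_conic_base_unique[OF assms(1) B' this] show ?thesis by simp
  qed
  have "(THE d. \<exists>B. normalized_conic_base B K \<and> d = - circ B) = - circ B"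
  proof (rule the_equality)
    show "\<exists>B'. normalized_conic_base B' K \<and> - circ B = - circ B'"
      using assms(1) by blast
  next
    fix d assume "\<exists>B'. normalized_conic_base B' K \<and> d = - circ B'"
    then obtain B' where "normalized_conic_base B' K" "d = - circ B'" by blast
    from this(2) eq[OF this(1)] show "d = - circ B" by simp
  qed
  then show ?thesis
    using assms(2) by (simp add: circumcentric_direction_def)
qed

section \<open>The polar cone\<close>

text \<open>Reduces membership in the polar to the generators: a closed half-space bounded by a
  hyperplane through the origin is itself a convex cone.\<close>

lemma polar_convex_cone_hull: "polar (convex_cone hull S) = polar S"
proof
  show "polar (convex_cone hull S) \<subseteq> polar S"
    by (auto simp: polar_def hull_inc)
  show "polar S \<subseteq> polar (convex_cone hull S)"
  proof
    fix w assume "w \<in> polar S"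
    then have "convex_cone hull S \<subseteq> {z. w \<bullet> z \<le> 0}"
      by (intro hull_minimal convex_cone_halfspace_le) (auto simp: polar_def inner_commute)
    then show "w \<in> polar (convex_cone hull S)"
      by (auto simp: polar_def inner_commute)
  qed
qed

lemma circumcentric_direction_cball_subset_polar:
  assumes "polyhedral_cone K"
  shows "cball (circumcentric_direction K) ((norm (circumcentric_direction K))\<^sup>2) \<subseteq> polar K"
proof (cases "K = {0}")
  case True
  then show ?thesis by (auto simp: polar_def)
next
  case False
  obtain B where B: "normalized_conic_base B K"
    using normalized_conic_base_exists[OF assms] by blast
  have unit: "\<forall>u\<in>B. norm u = 1" and K: "convex_cone hull B = K"
    using B by (auto simp: normalized_conic_base_def conic_base_hull)
  show ?thesis
  proof
    fix w
    assume "w \<in> cball (circumcentric_direction K) ((norm (circumcentric_direction K))\<^sup>2)"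
    then have w: "norm (w + circ B) \<le> circ B \<bullet> circ B"
      unfolding circumcentric_direction_eq[OF B False]
      by (simp add: dist_norm power2_norm_eq_inner norm_minus_commute)
    have "u \<bullet> w \<le> 0" if "u \<in> B" for u
    proof -
      \<comment> \<open>Since \<open>u\<close> is a unit vector, the right side is at most
        \<open>circ B \<bullet> circ B\<close>, which is exactly the value of
        \<open>u \<bullet> circ B\<close> to be subtracted.\<close>
      have "u \<bullet> (w + circ B) \<le> norm u * norm (w + circ B)"
        by (rule norm_cauchy_schwarz)
      with w that unit inner_circ[OF unit that] show ?thesis
        by (simp add: inner_add_right inner_commute)
    qed
    then have "w \<in> polar B" by (auto simp: polar_def)
    then show "w \<in> polar K"
      using polar_convex_cone_hull[of B] K by simp
  qed
qed

theorem theorem2p11: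
  fixes K :: "(real ^ 'n) set" and d :: "real ^ 'n"
  assumes "polyhedral_cone K"
    and "d = circumcentric_direction K"
  shows "(\<forall>v. norm v \<le> (norm d)\<^sup>2 \<longrightarrow> d + v \<in> polar K)
    \<and> d \<in> polar K
    \<and> (d \<noteq> 0 \<longrightarrow> (\<forall>v. norm v < (norm d)\<^sup>2 \<longrightarrow> d + v \<in> interior (polar K)))"
proof -
  have sub: "cball d ((norm d)\<^sup>2) \<subseteq> polar K"
    using circumcentric_direction_cball_subset_polar[OF assms(1)] assms(2) by simp
  have "d + v \<in> polar K" if "norm v \<le> (norm d)\<^sup>2" for v
    using that sub by (auto simp: dist_norm)
  moreover have "d \<in> polar K"
    using sub by auto
  moreover have "d + v \<in> interior (polar K)" if "norm v < (norm d)\<^sup>2" for v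
  proof -
    \<comment> \<open>The open ball is an open subset of the polar, so it lies in the
      interior.\<close>
    have "ball d ((norm d)\<^sup>2) \<subseteq> interior (polar K)"
      using sub ball_subset_cball by (intro interior_maximal) (blast, simp)
    then show ?thesis
      using that by (auto simp: dist_norm)
  qed
  ultimately show ?thesis by blast
qed

end
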